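(* Let $G$ be a $6$-edge-connected $6$-regular signed graph with an odd number of negative edges which contains two edge-disjoint unbalanced circuits. Then $G$ has a rooted $3$-odd decomposition, i.e.\ there exist three subgraphs $G_1,G_2,G_3$ whose edge sets partition $E(G)$, each $G_i$ being an eulerian subgraph with an odd number of negative edges, and a vertex of $G$ lying in all of $G_1,G_2,G_3$.
   Context: Graphs are finite and may have multiple edges and loops (a loop contributes $2$ to the degree). A signed graph is a graph with a signature assigning $+1$ (positive) or $-1$ (negative) to each edge. A circuit (closed trail with distinct inner vertices; a loop is a circuit) is unbalanced if it contains an odd number of negative edges. A graph is eulerian if it is connected and all degrees are even. A graph is $k$-edge-connected if removing fewer than $k$ edges leaves it connected; by convention, a graph with a single vertex and $d$ loops has edge-connectivity $2d$ (so the one-vertex graph with three loops counts as $6$-edge-connected). *)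

theory Defs
  imports "HOL-Library.Uprod"
begin

text \<open>Signed multigraphs. Edges are abstract names, so parallel edges are distinct elements of
  \<open>edges\<close>; a loop at \<open>v\<close> is an edge whose ends are \<open>Upair v v\<close>. The values of \<open>ends\<close> and \<open>sign\<close>
  outside \<open>edges\<close> are irrelevant.\<close>

record ('v, 'e) sgraph =
  verts :: "'v set"
  edges :: "'e set"
  ends :: "'e \<Rightarrow> 'v uprod"
  sign :: "'e \<Rightarrow> int"

definition signed_graph :: "('v, 'e) sgraph \<Rightarrow> bool" where
  "signed_graph G \<longleftrightarrow> finite (verts G) \<and> finite (edges G) \<and>
     (\<forall>e\<in>edges G. set_uprod (ends G e) \<subseteq> verts G \<and> sign G e \<in> {1, -1})"

definition neg_edges :: "('v, 'e) sgraph \<Rightarrow> 'e set" where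
  "neg_edges G = {e \<in> edges G. sign G e = -1}"

text \<open>The second summand makes a loop contribute 2.\<close>

definition degree :: "('v, 'e) sgraph \<Rightarrow> 'v \<Rightarrow> nat" where
  "degree G v = card {e \<in> edges G. v \<in> set_uprod (ends G e)}
              + card {e \<in> edges G. ends G e = Upair v v}"

definition regular :: "nat \<Rightarrow> ('v, 'e) sgraph \<Rightarrow> bool" where
  "regular d G \<longleftrightarrow> (\<forall>v\<in>verts G. degree G v = d)"

text \<open>\<open>walk G p es\<close>: the vertex list \<open>p\<close> (one longer than \<open>es\<close>) and the edge list \<open>es\<close> describe
  a walk.\<close>

fun walk :: "('v, 'e) sgraph \<Rightarrow> 'v list \<Rightarrow> 'e list \<Rightarrow> bool" where
  "walk G [v] [] \<longleftrightarrow> v \<in> verts G"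
| "walk G (u # v # p) (e # es) \<longleftrightarrow>
     u \<in> verts G \<and> e \<in> edges G \<and> ends G e = Upair u v \<and> walk G (v # p) es"
| "walk G _ _ \<longleftrightarrow> False"

definition connected :: "('v, 'e) sgraph \<Rightarrow> bool" where
  "connected G \<longleftrightarrow> verts G \<noteq> {} \<and>
     (\<forall>u\<in>verts G. \<forall>v\<in>verts G. \<exists>p es. walk G p es \<and> hd p = u \<and> last p = v)"

definition eulerian :: "('v, 'e) sgraph \<Rightarrow> bool" where
  "eulerian G \<longleftrightarrow> connected G \<and> (\<forall>v\<in>verts G. even (degree G v))"

text \<open>Closed trails with at least one edge whose only vertex repetition is that of the first and
  the last vertex; \<open>es = [e]\<close> gives the loops.\<close>

definition circuit :: "('v, 'e) sgraph \<Rightarrow> 'v list \<Rightarrow> 'e list \<Rightarrow> bool" where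
  "circuit G p es \<longleftrightarrow>
     walk G p es \<and> es \<noteq> [] \<and> distinct es \<and> hd p = last p \<and> distinct (tl p)"

definition unbalanced :: "('v, 'e) sgraph \<Rightarrow> 'e list \<Rightarrow> bool" where
  "unbalanced G es \<longleftrightarrow> odd (card (set es \<inter> neg_edges G))"

definition remove_edges :: "('v, 'e) sgraph \<Rightarrow> 'e set \<Rightarrow> ('v, 'e) sgraph" where
  "remove_edges G F = G\<lparr>edges := edges G - F\<rparr>"

text \<open>The second conjunct is the convention that a graph with one vertex and \<open>d\<close> loops has
  edge-connectivity exactly \<open>2 * d\<close>.\<close>

definition edge_connected :: "nat \<Rightarrow> ('v, 'e) sgraph \<Rightarrow> bool" where
  "edge_connected k G \<longleftrightarrow>
     (\<forall>F. F \<subseteq> edges G \<and> card F < k \<longrightarrow> connected (remove_edges G F)) \<and>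
     (card (verts G) = 1 \<longrightarrow> k \<le> 2 * card (edges G))"

definition subgraph :: "('v, 'e) sgraph \<Rightarrow> ('v, 'e) sgraph \<Rightarrow> bool" where
  "subgraph H G \<longleftrightarrow> signed_graph H \<and> verts H \<subseteq> verts G \<and> edges H \<subseteq> edges G \<and>
     (\<forall>e\<in>edges H. ends H e = ends G e \<and> sign H e = sign G e)"

definition odd_eulerian_subgraph :: "('v, 'e) sgraph \<Rightarrow> ('v, 'e) sgraph \<Rightarrow> bool" where
  "odd_eulerian_subgraph H G \<longleftrightarrow> subgraph H G \<and> eulerian H \<and> odd (card (neg_edges H))"

definition rooted_3_odd_decomposition ::
  "('v, 'e) sgraph \<Rightarrow> ('v, 'e) sgraph \<Rightarrow> ('v, 'e) sgraph \<Rightarrow> ('v, 'e) sgraph \<Rightarrow> bool" where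
  "rooted_3_odd_decomposition G G1 G2 G3 \<longleftrightarrow>
     odd_eulerian_subgraph G1 G \<and> odd_eulerian_subgraph G2 G \<and> odd_eulerian_subgraph G3 G \<and>
     edges G1 \<union> edges G2 \<union> edges G3 = edges G \<and>
     edges G1 \<inter> edges G2 = {} \<and> edges G1 \<inter> edges G3 = {} \<and> edges G2 \<inter> edges G3 = {} \<and>
     (\<exists>v. v \<in> verts G1 \<inter> verts G2 \<inter> verts G3)"

end

(* Fix any vertex b. A complete splitting of a vertex v other than b (its six edges are joined in
   pairs, signs multiplied) can be undone in a rooted decomposition, so it suffices to split off all
   vertices but b and to end with an odd number, at least three, of negative loops at b. Two
   properties have to survive: all cuts have at least six edges, and every switching of the
   signature has at least three negative edges (initially because each switching contains an edge
   of each of the two unbalanced circuits).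

   Call two edges at v inseparable if their other ends lie in a common set avoiding v whose cut has
   exactly six edges. By uncrossing this is transitive with classes of size at most 3, and a pairing
   without inseparable pairs keeps all cuts at six or more. By Hall's theorem such a pairing exists
   between any three edges at v and the other three. If some switching has exactly three negative
   edges, choose the three edges so as to include its negative edges at v: then it keeps three
   negative edges, and any other switching differs from it by a cut of at least six edges.
   Otherwise every switching has at least five negative edges, at most three of them at v after
   possibly switching v, so a pairing destroys at most two. *)
theory Submission
  imports Defs
begin

section \<open>Cuts and splitting off\<close>

definition cut :: "('v, 'e) sgraph \<Rightarrow> 'v set \<Rightarrow> 'e set" where
  "cut G S = {e \<in> edges G. \<exists>u\<in>S. \<exists>w. w \<notin> S \<and> ends G e = Upair u w}"

text \<open>The effect of joining \<open>e\<close> and \<open>f\<close> on any edge set taken modulo 2 along the new edge, such as a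
  cut or the set of negative edges; the new edge keeps the name \<open>e\<close>.\<close>

definition merge :: "'e \<Rightarrow> 'e \<Rightarrow> 'e set \<Rightarrow> 'e set" where
  "merge e f T = T - {e, f} \<union> (if (e \<in> T) \<noteq> (f \<in> T) then {e} else {})"

text \<open>Intended for edges \<open>e\<close> and \<open>f\<close> joining a common vertex to \<open>x\<close> and \<open>y\<close> respectively.\<close>

definition split_off :: "'e \<Rightarrow> 'e \<Rightarrow> 'v \<Rightarrow> 'v \<Rightarrow> ('v, 'e) sgraph \<Rightarrow> ('v, 'e) sgraph" where
  "split_off e f x y G = G\<lparr>edges := edges G - {f}, ends := (ends G)(e := Upair x y),
     sign := (sign G)(e := sign G e * sign G f)\<rparr>"

text \<open>The negative edges of the signature switched at \<open>S\<close>. The signs of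
  \<open>G\<close> stay fixed; equivalent signatures are handled as a family of edge sets indexed by
  \<open>S\<close>.\<close>

abbreviation switched :: "('v, 'e) sgraph \<Rightarrow> 'v set \<Rightarrow> 'e set" where
  "switched G S \<equiv> sym_diff (neg_edges G) (cut G S)"

lemma card_sym_diff:
  assumes "finite A" "finite B"
  shows "card (sym_diff A B) + 2 * card (A \<inter> B) = card A + card B"
proof -
  have "card (sym_diff A B) = card (A - B) + card (B - A)"
    using assms by (intro card_Un_disjoint) auto
  moreover have "card A = card (A - B) + card (A \<inter> B)"
    using assms by (metis Int_commute card_Diff_subset_Int card_mono add.commute finite_Int inf_le2 le_add_diff_inverse)
  moreover have "card B = card (B - A) + card (A \<inter> B)"
    using assms by (metis Int_commute card_Diff_subset_Int card_mono add.commute finite_Int inf_le2 le_add_diff_inverse)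
  ultimately show ?thesis by simp
qed

section \<open>Cuts as edge sets modulo 2\<close>

lemma uprod_ends: obtains u w where "ends G e = Upair u w"
  by (cases "ends G e") auto

lemma mem_cut:
  assumes "ends G e = Upair u w"
  shows "e \<in> cut G S \<longleftrightarrow> e \<in> edges G \<and> (u \<in> S) \<noteq> (w \<in> S)"
  using assms unfolding cut_def by auto

lemma cut_subset: "cut G S \<subseteq> edges G"
  by (auto simp: cut_def)

lemma finite_cut: "finite (edges G) \<Longrightarrow> finite (cut G S)"
  using cut_subset finite_subset by metis

lemma finite_neg_edges: "finite (edges G) \<Longrightarrow> finite (neg_edges G)"
  by (auto simp: neg_edges_def)

lemma cut_sym_diff: "cut G (sym_diff S R) = sym_diff (cut G S) (cut G R)"
proof (rule set_eqI)
  fix e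
  obtain u w where "ends G e = Upair u w" by (rule uprod_ends)
  from mem_cut[OF this]
  show "e \<in> cut G (sym_diff S R) \<longleftrightarrow> e \<in> sym_diff (cut G S) (cut G R)"
    by auto
qed

lemma cut_empty [simp]: "cut G {} = {}"
  by (auto simp: cut_def)

lemma cut_Compl_verts:
  assumes "signed_graph G"
  shows "cut G (verts G - S) = cut G S"
proof (rule set_eqI)
  fix e
  obtain u w where uw: "ends G e = Upair u w" by (rule uprod_ends)
  have "e \<in> edges G \<Longrightarrow> u \<in> verts G \<and> w \<in> verts G"
    using assms uw by (auto simp: signed_graph_def)
  then show "e \<in> cut G (verts G - S) \<longleftrightarrow> e \<in> cut G S"
    by (auto simp: mem_cut[OF uw])
qed

lemma cut_singleton_iff:
  assumes "e \<in> edges G"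
  shows "e \<in> cut G {v} \<longleftrightarrow> v \<in> set_uprod (ends G e) \<and> ends G e \<noteq> Upair v v"
proof -
  obtain u w where uw: "ends G e = Upair u w" by (rule uprod_ends)
  then show ?thesis using assms by (auto simp: mem_cut[OF uw])
qed

text \<open>An \<open>f\<close> that lies in \<open>T\<close> without \<open>e\<close> is exchanged
  for \<open>e\<close>, so the size drops only when both are present and cancel.\<close>

lemma card_merge:
  assumes "finite T" "e \<noteq> f"
  shows "card T = card (merge e f T) + (if e \<in> T \<and> f \<in> T then 2 else 0)"
proof -
  have *: "finite (T - {e, f})" using assms by simp
  consider "e \<in> T" "f \<in> T" | "e \<in> T" "f \<notin> T" | "e \<notin> T" "f \<in> T" | "e \<notin> T" "f \<notin> T" by blast
  then show ?thesis
  proof cases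
    case 1
    then have T: "insert e (insert f (T - {e, f})) = T" and m: "merge e f T = T - {e, f}"
      by (auto simp: merge_def)
    have "card T = Suc (Suc (card (T - {e, f})))"
      by (subst T[symmetric]) (use * assms(2) in \<open>simp add: card_insert_if\<close>)
    then show ?thesis using 1 m by simp
  next
    case 2
    then have "merge e f T = T" by (auto simp: merge_def)
    then show ?thesis using 2 by simp
  next
    case 3
    then have T: "insert f (T - {e, f}) = T" and m: "merge e f T = insert e (T - {e, f})"
      by (auto simp: merge_def)
    have "card T = Suc (card (T - {e, f}))"
      by (subst T[symmetric], rule card_insert_disjoint) (use * in auto)
    moreover have "card (merge e f T) = Suc (card (T - {e, f}))"
      unfolding m by (rule card_insert_disjoint) (use * in auto)
    ultimately show ?thesis using 3 by simp
  next
    case 4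
    then have "merge e f T = T" by (auto simp: merge_def)
    then show ?thesis using 4 by simp
  qed
qed

lemma even_card_merge:
  assumes "finite T" "e \<noteq> f"
  shows "even (card (merge e f T)) \<longleftrightarrow> even (card T)"
  using card_merge[OF assms] by (simp split: if_splits)

lemma finite_merge: "finite T \<Longrightarrow> finite (merge e f T)"
  by (simp add: merge_def)

lemma merge_sym_diff: "e \<noteq> f \<Longrightarrow> merge e f (sym_diff A B) = sym_diff (merge e f A) (merge e f B)"
  unfolding merge_def by auto

text \<open>The common end \<open>v\<close> cancels modulo 2: an edge from \<open>x\<close> to
  \<open>y\<close> crosses \<open>S\<close> iff exactly one of \<open>e\<close> and \<open>f\<close>
  does.\<close>

lemma cut_split_off:
  assumes "e \<in> edges G" "f \<in> edges G" "e \<noteq> f" "ends G e = Upair v x" "ends G f = Upair v y"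
  shows "cut (split_off e f x y G) S = merge e f (cut G S)"
proof (rule set_eqI)
  fix g
  consider "g = e" | "g = f" "g \<noteq> e" | "g \<noteq> e" "g \<noteq> f" by blast
  then show "g \<in> cut (split_off e f x y G) S \<longleftrightarrow> g \<in> merge e f (cut G S)"
  proof cases
    case 1
    have "ends (split_off e f x y G) e = Upair x y" by (simp add: split_off_def)
    from mem_cut[OF this] mem_cut[OF assms(4)] mem_cut[OF assms(5)] show ?thesis
      using 1 assms by (auto simp: merge_def split_off_def)
  next
    case 2
    then show ?thesis by (auto simp: merge_def cut_def split_off_def)
  next
    case 3
    then show ?thesis by (auto simp: merge_def cut_def split_off_def)
  qed
qed

lemma neg_edges_split_off:
  assumes "signed_graph G" "e \<in> edges G" "f \<in> edges G" "e \<noteq> f"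
  shows "neg_edges (split_off e f x y G) = merge e f (neg_edges G)"
proof -
  have "sign G e = 1 \<or> sign G e = -1" "sign G f = 1 \<or> sign G f = -1"
    using assms by (auto simp: signed_graph_def)
  then have "g \<in> neg_edges (split_off e f x y G) \<longleftrightarrow> g \<in> merge e f (neg_edges G)" for g
    using assms(2-) by (cases "g = e"; cases "g = f")
      (auto simp: neg_edges_def merge_def split_off_def)
  then show ?thesis by blast
qed

text \<open>The edge sets of odd eulerian subgraphs through \<open>b\<close>. Parity of degrees and connectedness are
  both stated in terms of cuts, which transform uniformly under splitting.\<close>

definition rooted_odd :: "('v, 'e) sgraph \<Rightarrow> 'v \<Rightarrow> 'e set \<Rightarrow> bool" where
  "rooted_odd G b A \<longleftrightarrow> A \<subseteq> edges G \<and> odd (card (A \<inter> neg_edges G)) \<and>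
     (\<forall>S. even (card (A \<inter> cut G S))) \<and>
     (\<forall>S. b \<notin> S \<longrightarrow> (\<exists>e\<in>A. set_uprod (ends G e) \<inter> S \<noteq> {}) \<longrightarrow> A \<inter> cut G S \<noteq> {})"

definition decomposable :: "('v, 'e) sgraph \<Rightarrow> 'v \<Rightarrow> bool" where
  "decomposable G b \<longleftrightarrow> (\<exists>A B C. rooted_odd G b A \<and> rooted_odd G b B \<and> rooted_odd G b C \<and>
     A \<union> B \<union> C = edges G \<and> A \<inter> B = {} \<and> A \<inter> C = {} \<and> B \<inter> C = {})"

text \<open>The new edge is replaced by the path from \<open>x\<close> through \<open>v\<close> to
  \<open>y\<close>. Merging the enlarged set gives back \<open>A\<close> and preserves parity, so
  only the connectedness clause needs a separate argument.\<close>

lemma rooted_odd_split_off: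
  assumes G: "signed_graph G" "e \<in> edges G" "f \<in> edges G" "e \<noteq> f"
    "ends G e = Upair v x" "ends G f = Upair v y"
    and A: "rooted_odd (split_off e f x y G) b A"
  shows "rooted_odd G b (A \<union> (if e \<in> A then {f} else {}))" (is "rooted_odd G b ?B")
proof -
  let ?H = "split_off e f x y G"
  have sub: "A \<subseteq> edges G - {f}" using A by (auto simp: rooted_odd_def split_off_def)
  have fin: "finite (edges G)" using G by (auto simp: signed_graph_def)
  have merge: "merge e f (?B \<inter> T) = A \<inter> merge e f T" for T
    using sub G(4) by (auto simp: merge_def)
  have B: "?B \<subseteq> edges G" using sub G by auto
  have finB: "finite (?B \<inter> T)" for T using B fin finite_subset by blast
  have par: "even (card (?B \<inter> T)) \<longleftrightarrow> even (card (A \<inter> merge e f T))" for T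
    using even_card_merge[OF finB G(4)] merge by metis
  have cut: "cut ?H S = merge e f (cut G S)" for S
    using cut_split_off[OF G(2-)] .
  have "?B \<inter> cut G S \<noteq> {}"
    if b: "b \<notin> S" and g: "g \<in> ?B" "set_uprod (ends G g) \<inter> S \<noteq> {}" for S g
  proof (cases "A \<inter> cut ?H S = {}")
    case False
    then have "merge e f (?B \<inter> cut G S) \<noteq> {}" using merge cut by metis
    then show ?thesis by (auto simp: merge_def split: if_splits)
  next
    \<comment> \<open>No edge of \<open>A\<close> crosses \<open>S\<close> after the splitting, so
      none touches \<open>S\<close> there. An edge that touches \<open>S\<close> in \<open>G\<close>
      must then be \<open>e\<close> or \<open>f\<close>, with \<open>v\<close> in \<open>S\<close>
      but \<open>x\<close> and \<open>y\<close> outside, so \<open>e\<close> crosses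
      \<open>S\<close>.\<close>
    case True
    then have avoid: "set_uprod (ends ?H h) \<inter> S = {}" if "h \<in> A" for h
      using A b that unfolding rooted_odd_def by blast
    have gef: "g = e \<or> g = f"
    proof (rule ccontr)
      assume "\<not> ?thesis"
      then show False using avoid[of g] g by (auto simp: split_off_def split: if_splits)
    qed
    then have "e \<in> A" using g sub by (auto split: if_splits)
    moreover from avoid[OF this] have "x \<notin> S" "y \<notin> S" by (auto simp: split_off_def)
    moreover from this have "v \<in> S" using gef g G by auto
    ultimately have "e \<in> ?B \<inter> cut G S" using G(2) mem_cut[OF G(5)] by simp
    then show ?thesis by blast
  qed
  moreover have "odd (card (?B \<inter> neg_edges G))"
    using A unfolding rooted_odd_def par neg_edges_split_off[OF G(1-4)] by blast
  moreover have "even (card (?B \<inter> cut G S))" for S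
    using A unfolding rooted_odd_def par cut by blast
  ultimately show ?thesis
    using B unfolding rooted_odd_def by blast
qed

lemma decomposable_split_off:
  assumes "signed_graph G" "e \<in> edges G" "f \<in> edges G" "e \<noteq> f"
    "ends G e = Upair v x" "ends G f = Upair v y"
    and "decomposable (split_off e f x y G) b"
  shows "decomposable G b"
proof -
  obtain A B C where ABC: "rooted_odd (split_off e f x y G) b A"
    "rooted_odd (split_off e f x y G) b B" "rooted_odd (split_off e f x y G) b C"
    and part: "A \<union> B \<union> C = edges (split_off e f x y G)" "A \<inter> B = {}" "A \<inter> C = {}" "B \<inter> C = {}"
    using assms(7) by (auto simp: decomposable_def)
  have part': "A \<union> B \<union> C = edges G - {f}" using part by (simp add: split_off_def)
  let ?l = "\<lambda>A. A \<union> (if e \<in> A then {f} else {})"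
  have e: "e \<in> A \<union> B \<union> C" and f: "f \<notin> A" "f \<notin> B" "f \<notin> C" using part' assms by auto
  have "?l A \<union> ?l B \<union> ?l C = edges G" using e part' assms(3) by auto
  moreover have "?l A \<inter> ?l B = {}" "?l A \<inter> ?l C = {}" "?l B \<inter> ?l C = {}"
    using f part by auto
  moreover note ABC[THEN rooted_odd_split_off[OF assms(1-6)]]
  ultimately have "rooted_odd G b (?l A) \<and> rooted_odd G b (?l B) \<and> rooted_odd G b (?l C) \<and>
     ?l A \<union> ?l B \<union> ?l C = edges G \<and> ?l A \<inter> ?l B = {} \<and> ?l A \<inter> ?l C = {} \<and> ?l B \<inter> ?l C = {}"
    by (intro conjI)
  then show ?thesis
    unfolding decomposable_def by (intro exI)
qed

text \<open>The invariant of the induction. The degree condition spares \<open>b\<close>, which acquires loops.\<close>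

definition six_linked :: "('v, 'e) sgraph \<Rightarrow> 'v \<Rightarrow> bool" where
  "six_linked G b \<longleftrightarrow> signed_graph G \<and> b \<in> verts G \<and>
     (\<forall>S. S \<subseteq> verts G \<longrightarrow> S \<noteq> {} \<longrightarrow> S \<noteq> verts G \<longrightarrow> 6 \<le> card (cut G S)) \<and>
     (\<forall>S. even (card (cut G S))) \<and>
     (\<forall>u\<in>verts G - {b}. card (cut G {u}) = 6 \<and> (\<forall>e\<in>edges G. ends G e \<noteq> Upair u u)) \<and>
     (\<forall>S. odd (card (switched G S)) \<and> 3 \<le> card (switched G S))"

section \<open>Pairing the edges at a vertex\<close>

text \<open>Hall's condition in Frobenius-Koenig form: a 3 by 3 array has no transversal of
  unrelated pairs only if it contains a 1 by 3, 2 by 2 or 3 by 1 block of related pairs. Such a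
  block lies in a single class of \<open>R\<close>, which would have four elements.\<close>

lemma cross_matching:
  assumes "card E = 6" "T \<subseteq> E" "card T = 3"
    and sym: "\<And>e f. R e f \<Longrightarrow> R f e"
    and trans: "\<And>e f g. e \<in> E \<Longrightarrow> f \<in> E \<Longrightarrow> g \<in> E \<Longrightarrow> R e f \<Longrightarrow> R f g \<Longrightarrow> R e g"
    and small: "\<And>e. e \<in> E \<Longrightarrow> card {f \<in> E. R e f} \<le> 3"
  obtains a b c a' b' c' where "E = {a, b, c, a', b', c'}" "T = {a, b, c}"
    "distinct [a, b, c, a', b', c']" "\<not> R a a'" "\<not> R b b'" "\<not> R c c'"
proof -
  note found = that
  have fin: "finite E" using assms(1) by (metis card.infinite zero_neq_numeral)
  obtain a b c where T: "T = {a, b, c}" "distinct [a, b, c]"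
    using assms(3) by (auto simp: card_3_iff)
  have "card (E - T) = 3" using assms fin by (simp add: card_Diff_subset finite_subset)
  then obtain x y z where U: "E - T = {x, y, z}" "distinct [x, y, z]"
    by (auto simp: card_3_iff)
  have E: "E = {a, b, c, x, y, z}" and d: "distinct [a, b, c, x, y, z]"
    using T U assms(2) by auto
  have no4: False
    if "{p, q, r, s} \<subseteq> E" "distinct [p, q, r, s]" "R p q" "R p r" "R p s" for p q r s
  proof -
    \<comment> \<open>Symmetry and transitivity put \<open>p\<close> into its own class, which
      thereby reaches size four.\<close>
    have "R p p" using that sym trans by (meson insert_subset)
    then have "{p, q, r, s} \<subseteq> {f \<in> E. R p f}" using that by auto
    then have "card {p, q, r, s} \<le> card {f \<in> E. R p f}" using fin by (intro card_mono) auto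
    then show False using small[of p] that by simp
  qed
  have no4': False
    if "{p, q, r, s} \<subseteq> E" "distinct [p, q, r, s]" "R p r" "R p s" "R q r" "R q s" for p q r s
    using that no4[of p q r s] trans[of p r q] sym by auto
  have perm: thesis if "{x', y', z'} = {x, y, z}" "distinct [x', y', z']"
    "\<not> R a x'" "\<not> R b y'" "\<not> R c z'" for x' y' z'
    using that(2-) E d T(1) that(1) by (intro found[of a b c x' y' z']) auto
  show thesis
  proof (rule ccontr)
    assume n: "\<not> thesis"
    \<comment> \<open>One clause for each of the six bijections from \<open>T\<close> to
      \<open>E - T\<close>. The clauses collected below exclude the three kinds of blocks, and the
      rest is propositional.\<close>
    have "R a x \<or> R b y \<or> R c z" "R a x \<or> R b z \<or> R c y" "R a y \<or> R b x \<or> R c z"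
      "R a y \<or> R b z \<or> R c x" "R a z \<or> R b x \<or> R c y" "R a z \<or> R b y \<or> R c x"
      using perm n d by auto
    moreover have "\<not> (R p x \<and> R p y \<and> R p z)" if "p \<in> {a, b, c}" for p
      using that no4[of p x y z] d E by auto
    then have "\<not> (R a x \<and> R a y \<and> R a z)" "\<not> (R b x \<and> R b y \<and> R b z)" "\<not> (R c x \<and> R c y \<and> R c z)"
      by simp_all
    moreover have "\<not> (R a p \<and> R b p \<and> R c p)" if "p \<in> {x, y, z}" for p
      using that no4[of p a b c] sym d E by auto
    then have "\<not> (R a x \<and> R b x \<and> R c x)" "\<not> (R a y \<and> R b y \<and> R c y)" "\<not> (R a z \<and> R b z \<and> R c z)"
      by simp_all
    moreover have "\<forall>(p, q) \<in> {(a, b), (a, c), (b, c)}. \<forall>(r, s) \<in> {(x, y), (x, z), (y, z)}.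
      \<not> (R p r \<and> R p s \<and> R q r \<and> R q s)"
      using no4' d E by auto
    then have "\<not> (R a x \<and> R a y \<and> R b x \<and> R b y)"
      "\<not> (R a x \<and> R a z \<and> R b x \<and> R b z)"
      "\<not> (R a y \<and> R a z \<and> R b y \<and> R b z)"
      "\<not> (R a x \<and> R a y \<and> R c x \<and> R c y)"
      "\<not> (R a x \<and> R a z \<and> R c x \<and> R c z)"
      "\<not> (R a y \<and> R a z \<and> R c y \<and> R c z)"
      "\<not> (R b x \<and> R b y \<and> R c x \<and> R c y)"
      "\<not> (R b x \<and> R b z \<and> R c x \<and> R c z)"
      "\<not> (R b y \<and> R b z \<and> R c y \<and> R c z)"
      by simp_all
    ultimately show False by argo
  qed
qed

section \<open>Complete splitting of a vertex of degree six\<close>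

lemma cut_singletonE:
  assumes "e \<in> cut G {v}"
  obtains x where "e \<in> edges G" "ends G e = Upair v x" "x \<noteq> v"
  using assms by (auto simp: cut_def)

lemma signed_graph_split_off:
  assumes "signed_graph G" "e \<in> edges G" "f \<in> edges G" "x \<in> verts G" "y \<in> verts G"
  shows "signed_graph (split_off e f x y G)"
proof -
  have "sign G e = 1 \<or> sign G e = -1" "sign G f = 1 \<or> sign G f = -1"
    using assms(1-3) by (auto simp: signed_graph_def)
  then have "sign G e * sign G f = 1 \<or> sign G e * sign G f = -1" by auto
  then show ?thesis using assms by (auto simp: signed_graph_def split_off_def)
qed

lemma decomposable_verts_update: "decomposable (G\<lparr>verts := W\<rparr>) b \<longleftrightarrow> decomposable G b"
  by (simp add: decomposable_def rooted_odd_def cut_def neg_edges_def)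

text \<open>Having no loops, \<open>v\<close> is isolated after three splittings and can be deleted.
  The clause on loops later keeps vertices other than \<open>b\<close> loopless: a new loop at
  \<open>u\<close> needs a pair whose other ends both equal \<open>u\<close>.\<close>

lemma complete_split_off:
  assumes G: "signed_graph G" and v: "cut G {v} = {e1, e2, e3, f1, f2, f3}"
    and dist: "distinct [e1, e2, e3, f1, f2, f3]" and loopless: "\<forall>e\<in>edges G. ends G e \<noteq> Upair v v"
  obtains H where "signed_graph H" "verts H = verts G - {v}"
    "\<And>S. cut H S = merge e3 f3 (merge e2 f2 (merge e1 f1 (cut G S)))"
    "neg_edges H = merge e3 f3 (merge e2 f2 (merge e1 f1 (neg_edges G)))"
    "\<And>u e. e \<in> edges H \<Longrightarrow> ends H e = Upair u u \<Longrightarrow>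
       (e \<in> edges G \<and> ends G e = Upair u u) \<or>
       (\<exists>(e, f) \<in> {(e1, f1), (e2, f2), (e3, f3)}. e \<in> cut G {u} \<and> f \<in> cut G {u})"
    "\<And>b. decomposable H b \<Longrightarrow> decomposable G b"
proof -
  have at_v: "e1 \<in> cut G {v}" "e2 \<in> cut G {v}" "e3 \<in> cut G {v}"
    "f1 \<in> cut G {v}" "f2 \<in> cut G {v}" "f3 \<in> cut G {v}" using v by auto
  obtain x1 where e1: "e1 \<in> edges G" "ends G e1 = Upair v x1" "x1 \<noteq> v" by (rule cut_singletonE[OF at_v(1)])
  obtain x2 where e2: "e2 \<in> edges G" "ends G e2 = Upair v x2" "x2 \<noteq> v" by (rule cut_singletonE[OF at_v(2)])
  obtain x3 where e3: "e3 \<in> edges G" "ends G e3 = Upair v x3" "x3 \<noteq> v" by (rule cut_singletonE[OF at_v(3)])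
  obtain y1 where f1: "f1 \<in> edges G" "ends G f1 = Upair v y1" "y1 \<noteq> v" by (rule cut_singletonE[OF at_v(4)])
  obtain y2 where f2: "f2 \<in> edges G" "ends G f2 = Upair v y2" "y2 \<noteq> v" by (rule cut_singletonE[OF at_v(5)])
  obtain y3 where f3: "f3 \<in> edges G" "ends G f3 = Upair v y3" "y3 \<noteq> v" by (rule cut_singletonE[OF at_v(6)])
  have in_verts: "set_uprod (ends G e) \<subseteq> verts G" if "e \<in> edges G" for e
    using G that by (auto simp: signed_graph_def)
  have x: "x1 \<in> verts G" "x2 \<in> verts G" "x3 \<in> verts G" "y1 \<in> verts G" "y2 \<in> verts G" "y3 \<in> verts G"
    using in_verts[OF e1(1)] in_verts[OF e2(1)] in_verts[OF e3(1)] in_verts[OF f1(1)]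
      in_verts[OF f2(1)] in_verts[OF f3(1)] e1 e2 e3 f1 f2 f3 by auto
  define G1 where "G1 = split_off e1 f1 x1 y1 G"
  define G2 where "G2 = split_off e2 f2 x2 y2 G1"
  define G3 where "G3 = split_off e3 f3 x3 y3 G2"
  have verts: "verts G1 = verts G" "verts G2 = verts G" "verts G3 = verts G"
    by (simp_all add: G1_def G2_def G3_def split_off_def)
  have G1: "signed_graph G1" "e2 \<in> edges G1" "f2 \<in> edges G1" "e2 \<noteq> f2"
    "ends G1 e2 = Upair v x2" "ends G1 f2 = Upair v y2"
    using signed_graph_split_off[OF G] e1 f1 e2 f2 x dist unfolding G1_def
    by (auto simp: split_off_def)
  have G2: "signed_graph G2" "e3 \<in> edges G2" "f3 \<in> edges G2" "e3 \<noteq> f3"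
    "ends G2 e3 = Upair v x3" "ends G2 f3 = Upair v y3"
    using signed_graph_split_off[OF G1(1-3)] e3 f3 x dist verts unfolding G2_def
    by (auto simp: split_off_def G1_def)
  have G3: "signed_graph G3"
    using signed_graph_split_off[OF G2(1-3)] x verts unfolding G3_def by auto
  have G0: "signed_graph G" "e1 \<in> edges G" "f1 \<in> edges G" "e1 \<noteq> f1"
    "ends G e1 = Upair v x1" "ends G f1 = Upair v y1" using G e1 f1 dist by auto
  let ?H = "G3\<lparr>verts := verts G - {v}\<rparr>"
  have old: "e \<in> {e1, e2, e3} \<or> e \<in> edges G - cut G {v} \<and> ends G3 e = ends G e"
    if "e \<in> edges G3" for e
    using that unfolding v by (auto simp: G1_def G2_def G3_def split_off_def)
  have new: "ends G3 e1 = Upair x1 y1" "ends G3 e2 = Upair x2 y2" "ends G3 e3 = Upair x3 y3"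
    using dist by (auto simp: G1_def G2_def G3_def split_off_def)
  have "set_uprod (ends G3 e) \<subseteq> verts G - {v}" if e: "e \<in> edges G3" for e
    using old[OF e]
  proof
    assume "e \<in> {e1, e2, e3}"
    then show ?thesis using new x e1 e2 e3 f1 f2 f3 by auto
  next
    assume e: "e \<in> edges G - cut G {v} \<and> ends G3 e = ends G e"
    then have "v \<notin> set_uprod (ends G e)"
      using cut_singleton_iff[of e G v] loopless by blast
    then show ?thesis using in_verts e by auto
  qed
  then have "signed_graph ?H" using G3 G by (auto simp: signed_graph_def)
  moreover have "verts ?H = verts G - {v}" by simp
  moreover have "cut ?H S = merge e3 f3 (merge e2 f2 (merge e1 f1 (cut G S)))" for S
  proof -
    have "cut ?H S = cut G3 S" by (simp add: cut_def)
    then show ?thesis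
      using cut_split_off[OF G0(2-)] cut_split_off[OF G1(2-)] cut_split_off[OF G2(2-)]
      by (simp add: G1_def G2_def G3_def)
  qed
  moreover have "neg_edges ?H = merge e3 f3 (merge e2 f2 (merge e1 f1 (neg_edges G)))"
  proof -
    have "neg_edges ?H = neg_edges G3" by (simp add: neg_edges_def)
    then show ?thesis
      using neg_edges_split_off[OF G0(1-4)] neg_edges_split_off[OF G1(1-4)]
        neg_edges_split_off[OF G2(1-4)]
      by (simp add: G1_def G2_def G3_def)
  qed
  moreover have "(e \<in> edges G \<and> ends G e = Upair u u) \<or>
       (\<exists>(e, f) \<in> {(e1, f1), (e2, f2), (e3, f3)}. e \<in> cut G {u} \<and> f \<in> cut G {u})"
    if "e \<in> edges ?H" "ends ?H e = Upair u u" for u e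
  proof -
    have "e \<in> edges G3" "ends G3 e = Upair u u" using that by simp_all
    from old[OF this(1)] this(2) show ?thesis
      using new e1 e2 e3 f1 f2 f3 mem_cut[OF e1(2), of "{u}"] mem_cut[OF e2(2), of "{u}"]
        mem_cut[OF e3(2), of "{u}"] mem_cut[OF f1(2), of "{u}"] mem_cut[OF f2(2), of "{u}"]
        mem_cut[OF f3(2), of "{u}"] by auto
  qed
  moreover have "decomposable G b" if "decomposable ?H b" for b
    using that decomposable_split_off[OF G0] decomposable_split_off[OF G1]
      decomposable_split_off[OF G2]
    by (simp add: decomposable_verts_update G1_def G2_def G3_def)
  ultimately show thesis by (rule that)
qed

lemma card_merge3:
  assumes "finite T" "distinct [e1, e2, e3, f1, f2, f3]"
  shows "card T = card (merge e3 f3 (merge e2 f2 (merge e1 f1 T)))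
    + (if e1 \<in> T \<and> f1 \<in> T then 2 else 0) + (if e2 \<in> T \<and> f2 \<in> T then 2 else 0)
    + (if e3 \<in> T \<and> f3 \<in> T then 2 else 0)"
proof -
  define T1 where "T1 = merge e1 f1 T"
  define T2 where "T2 = merge e2 f2 T1"
  have fin: "finite T1" "finite T2" using assms by (simp_all add: T1_def T2_def finite_merge)
  have m: "e2 \<in> T1 \<longleftrightarrow> e2 \<in> T" "f2 \<in> T1 \<longleftrightarrow> f2 \<in> T" "e3 \<in> T2 \<longleftrightarrow> e3 \<in> T" "f3 \<in> T2 \<longleftrightarrow> f3 \<in> T"
    using assms(2) by (auto simp: T1_def T2_def merge_def)
  have "card T = card T1 + (if e1 \<in> T \<and> f1 \<in> T then 2 else 0)"
    unfolding T1_def using assms by (intro card_merge) auto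
  moreover have "card T1 = card T2 + (if e2 \<in> T \<and> f2 \<in> T then 2 else 0)"
    unfolding m(1,2)[symmetric] unfolding T2_def using assms fin by (intro card_merge) auto
  moreover have "card T2 = card (merge e3 f3 T2) + (if e3 \<in> T \<and> f3 \<in> T then 2 else 0)"
    unfolding m(3,4)[symmetric] using assms fin by (intro card_merge) auto
  ultimately show ?thesis by (simp add: T1_def T2_def)
qed

text \<open>The set \<open>verts G - {v}\<close> is excluded because its cut is that of
  \<open>{v}\<close>, which has six edges when \<open>v\<close> has degree six: it would make all
  edges at \<open>v\<close> inseparable.\<close>

definition tight :: "('v, 'e) sgraph \<Rightarrow> 'v \<Rightarrow> 'v set \<Rightarrow> bool" where
  "tight G v X \<longleftrightarrow> X \<subseteq> verts G - {v} \<and> X \<noteq> {} \<and> X \<noteq> verts G - {v} \<and> card (cut G X) = 6"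

text \<open>With \<open>c\<close> edges between \<open>v\<close> and \<open>X\<close>, adding
  \<open>v\<close> to \<open>X\<close> gives a cut of 6 + 6 - 2c edges, and this must be at least
  six.\<close>

lemma tight_card:
  assumes "six_linked G b" "v \<in> verts G - {b}" "tight G v X"
  shows "card (cut G {v} \<inter> cut G X) \<le> 3"
proof -
  have fin: "finite (cut G S)" for S
    using assms by (intro finite_cut) (auto simp: six_linked_def signed_graph_def)
  have X: "X \<subseteq> verts G - {v}" "X \<noteq> {}" "X \<noteq> verts G - {v}" "card (cut G X) = 6"
    using assms by (auto simp: tight_def)
  have "sym_diff {v} X = insert v X" using X by auto
  then have eq: "cut G (insert v X) = sym_diff (cut G {v}) (cut G X)"
    using cut_sym_diff[of G "{v}" X] by simp
  have "6 \<le> card (cut G (insert v X))"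
  proof -
    have "insert v X \<noteq> verts G" "insert v X \<subseteq> verts G" using X assms by auto
    then show ?thesis using assms unfolding six_linked_def by blast
  qed
  moreover have "card (cut G {v}) = 6" using assms by (auto simp: six_linked_def)
  ultimately show ?thesis
    using card_sym_diff[OF fin fin, of "{v}" X] X(4) unfolding eq by simp
qed

section \<open>Uncrossing tight sets\<close>

lemma cut_submodular:
  assumes "finite (edges G)"
  shows "card (cut G (X \<inter> Y)) + card (cut G (X \<union> Y)) \<le> card (cut G X) + card (cut G Y)"
proof -
  have fin: "finite (cut G S)" for S using assms by (rule finite_cut)
  have *: "(e \<in> cut G (X \<inter> Y) \<or> e \<in> cut G (X \<union> Y) \<longrightarrow> e \<in> cut G X \<or> e \<in> cut G Y) \<and>
    (e \<in> cut G (X \<inter> Y) \<and> e \<in> cut G (X \<union> Y) \<longrightarrow> e \<in> cut G X \<and> e \<in> cut G Y)" for e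
  proof -
    obtain u w where uw: "ends G e = Upair u w" by (rule uprod_ends)
    show ?thesis unfolding mem_cut[OF uw] by auto
  qed
  have "card (cut G (X \<inter> Y) \<union> cut G (X \<union> Y)) \<le> card (cut G X \<union> cut G Y)"
    "card (cut G (X \<inter> Y) \<inter> cut G (X \<union> Y)) \<le> card (cut G X \<inter> cut G Y)"
    using * by (intro card_mono; use fin in blast)+
  then show ?thesis
    using card_Un_Int[OF fin fin, of X Y] card_Un_Int[OF fin fin, of "X \<inter> Y" "X \<union> Y"] by linarith
qed

text \<open>The hypotheses force \<open>e\<close> to run from \<open>X \<inter> Y\<close> to the
  outside of \<open>X \<union> Y\<close>. It counts twice on the right and never on the left, hence
  the strict inequality.\<close>

lemma cut_posimodular:
  assumes "finite (edges G)" "e \<in> cut G X" "e \<in> cut G Y" "e \<notin> cut G (X - Y)"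
  shows "card (cut G (X - Y)) + card (cut G (Y - X)) < card (cut G X) + card (cut G Y)"
proof -
  have fin: "finite (cut G S)" for S using assms(1) by (rule finite_cut)
  have *: "(e \<in> cut G (X - Y) \<or> e \<in> cut G (Y - X) \<longrightarrow> e \<in> cut G X \<or> e \<in> cut G Y) \<and>
    (e \<in> cut G (X - Y) \<and> e \<in> cut G (Y - X) \<longrightarrow> e \<in> cut G X \<and> e \<in> cut G Y)" for e
  proof -
    obtain u w where uw: "ends G e = Upair u w" by (rule uprod_ends)
    show ?thesis unfolding mem_cut[OF uw] by auto
  qed
  have "card (cut G (X - Y) \<union> cut G (Y - X)) \<le> card (cut G X \<union> cut G Y)"
    using * by (intro card_mono; use fin in blast)
  moreover have "card (cut G (X - Y) \<inter> cut G (Y - X)) < card (cut G X \<inter> cut G Y)"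
    using * assms by (intro psubset_card_mono; use fin in blast)
  ultimately show ?thesis
    using card_Un_Int[OF fin fin, of X Y] card_Un_Int[OF fin fin, of "X - Y" "Y - X"] by linarith
qed

text \<open>The other end of \<open>e\<close> lies in both sets, so submodularity gives the union a
  cut of six edges. If the union were all of \<open>verts G - {v}\<close>, both differences would be
  nonempty with cuts of at least six edges, against the strict posimodular inequality.\<close>

lemma tight_Un:
  assumes G: "six_linked G b" "v \<in> verts G - {b}" and X: "tight G v X" and Y: "tight G v Y"
    and e: "e \<in> cut G {v}" "e \<in> cut G X" "e \<in> cut G Y"
  shows "tight G v (X \<union> Y)"
proof -
  have fin: "finite (edges G)" using G by (auto simp: six_linked_def signed_graph_def)
  have big: "6 \<le> card (cut G S)" if "S \<subseteq> verts G - {v}" "S \<noteq> {}" for S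
    using that G unfolding six_linked_def by blast
  obtain x where x: "e \<in> edges G" "ends G e = Upair v x" "x \<noteq> v" by (rule cut_singletonE[OF e(1)])
  have in_cut: "e \<in> cut G S \<longleftrightarrow> x \<in> S" if "v \<notin> S" for S
    using that x(1) mem_cut[OF x(2)] by simp
  have XY: "X \<subseteq> verts G - {v}" "Y \<subseteq> verts G - {v}" "X \<noteq> {}" "Y \<noteq> {}" "X \<noteq> verts G - {v}"
    "Y \<noteq> verts G - {v}" "card (cut G X) = 6" "card (cut G Y) = 6"
    using X Y by (auto simp: tight_def)
  have xXY: "x \<in> X" "x \<in> Y" using e in_cut[of X] in_cut[of Y] XY by auto
  have "X \<union> Y \<noteq> verts G - {v}"
  proof
    assume "X \<union> Y = verts G - {v}"
    then have "X - Y \<noteq> {}" "Y - X \<noteq> {}" using XY by auto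
    then have "6 \<le> card (cut G (X - Y))" "6 \<le> card (cut G (Y - X))"
      using XY by (auto intro!: big)
    moreover have "e \<notin> cut G (X - Y)" using in_cut[of "X - Y"] xXY XY by auto
    ultimately show False using cut_posimodular[OF fin e(2,3)] XY by simp
  qed
  moreover have "6 \<le> card (cut G (X \<inter> Y))" "6 \<le> card (cut G (X \<union> Y))"
    using XY xXY by (auto intro!: big)
  then have "card (cut G (X \<union> Y)) = 6"
    using cut_submodular[OF fin, of X Y] XY by simp
  ultimately show ?thesis using XY by (auto simp: tight_def)
qed

text \<open>For an edge at \<open>v\<close>, which lies outside \<open>X\<close>, being in
  \<open>cut G X\<close> means that its other end lies in \<open>X\<close>. Joining two such edges
  would bring this cut below six.\<close>

definition inseparable :: "('v, 'e) sgraph \<Rightarrow> 'v \<Rightarrow> 'e \<Rightarrow> 'e \<Rightarrow> bool" where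
  "inseparable G v e f \<longleftrightarrow> (\<exists>X. tight G v X \<and> e \<in> cut G X \<and> f \<in> cut G X)"

lemma in_cut_mono:
  assumes "e \<in> cut G {v}" "e \<in> cut G X" "X \<subseteq> Y" "v \<notin> Y"
  shows "e \<in> cut G Y"
proof -
  obtain x where x: "e \<in> edges G" "ends G e = Upair v x" "x \<noteq> v" by (rule cut_singletonE[OF assms(1)])
  then show ?thesis using assms mem_cut[OF x(2)] by auto
qed

lemma inseparable_sym: "inseparable G v e f \<Longrightarrow> inseparable G v f e"
  by (auto simp: inseparable_def)

lemma inseparable_trans:
  assumes G: "six_linked G b" "v \<in> verts G - {b}"
    and "e \<in> cut G {v}" "f \<in> cut G {v}" "g \<in> cut G {v}" "inseparable G v e f" "inseparable G v f g"
  shows "inseparable G v e g"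
proof -
  obtain X Y where XY: "tight G v X" "e \<in> cut G X" "f \<in> cut G X"
    "tight G v Y" "f \<in> cut G Y" "g \<in> cut G Y"
    using assms by (auto simp: inseparable_def)
  have t: "tight G v (X \<union> Y)" using tight_Un[OF G XY(1,4) assms(4) XY(3,5)] .
  then have "v \<notin> X \<union> Y" by (auto simp: tight_def)
  then have "e \<in> cut G (X \<union> Y)" "g \<in> cut G (X \<union> Y)"
    using in_cut_mono[OF assms(3) XY(2)] in_cut_mono[OF assms(5) XY(6)] by auto
  then show ?thesis using t by (auto simp: inseparable_def)
qed

text \<open>A largest tight set \<open>X\<close> containing the other end of \<open>e\<close>
  absorbs, by \<open>tight_Un\<close>, every tight set that witnesses inseparability from
  \<open>e\<close>. The whole class thus joins \<open>v\<close> to \<open>X\<close>, and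
  \<open>tight_card\<close> applies.\<close>

lemma inseparable_small:
  assumes G: "six_linked G b" "v \<in> verts G - {b}" and e: "e \<in> cut G {v}"
  shows "card {f \<in> cut G {v}. inseparable G v e f} \<le> 3"
proof (cases "\<exists>X. tight G v X \<and> e \<in> cut G X")
  case False
  then have "{f \<in> cut G {v}. inseparable G v e f} = {}" by (auto simp: inseparable_def)
  then show ?thesis by (metis card.empty zero_le)
next
  case True
  then obtain Z where Z: "tight G v Z \<and> e \<in> cut G Z" by blast
  have fin: "finite (verts G)" "finite (edges G)"
    using G by (auto simp: six_linked_def signed_graph_def)
  have "card Y < Suc (card (verts G))" if "tight G v Y" for Y
  proof -
    have "Y \<subseteq> verts G" using that by (auto simp: tight_def)
    then show ?thesis using card_mono[OF fin(1)] by (simp add: less_Suc_eq_le)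
  qed
  then obtain X where X: "tight G v X" "e \<in> cut G X"
    and max: "\<And>Y. tight G v Y \<Longrightarrow> e \<in> cut G Y \<Longrightarrow> card Y \<le> card X"
    using ex_has_greatest_nat[where P = "\<lambda>Y. tight G v Y \<and> e \<in> cut G Y" and f = card, OF Z] by blast
  have v: "v \<notin> X" and finX: "finite X" using X fin finite_subset by (auto simp: tight_def)
  have "f \<in> cut G X" if f: "f \<in> cut G {v}" "inseparable G v e f" for f
  proof -
    obtain Y where Y: "tight G v Y" "e \<in> cut G Y" "f \<in> cut G Y"
      using f by (auto simp: inseparable_def)
    have t: "tight G v (X \<union> Y)" using tight_Un[OF G X(1) Y(1) e X(2) Y(2)] .
    then have vXY: "v \<notin> X \<union> Y" and "finite (X \<union> Y)"
      using fin finite_subset by (auto simp: tight_def)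
    then have "card (X \<union> Y) \<le> card X" using max[OF t in_cut_mono[OF e X(2)]] by auto
    then have "X = X \<union> Y" using card_seteq[OF \<open>finite (X \<union> Y)\<close>, of X] by auto
    then show ?thesis using in_cut_mono[OF f(1) Y(3), of X] v by auto
  qed
  then have "{f \<in> cut G {v}. inseparable G v e f} \<subseteq> cut G {v} \<inter> cut G X" by auto
  then have "card {f \<in> cut G {v}. inseparable G v e f} \<le> card (cut G {v} \<inter> cut G X)"
    using finite_cut[OF fin(2)] by (intro card_mono) auto
  then show ?thesis using tight_card[OF G X(1)] by linarith
qed

section \<open>The two ends of the induction\<close>

text \<open>Used in two ways: a walk between different sides of a cut crosses it, and a closed walk
  crosses it an even number of times.\<close>

lemma walk_crossings:
  "walk G p es \<Longrightarrow> odd (length (filter (\<lambda>e. e \<in> cut G S) es)) \<longleftrightarrow> (hd p \<in> S) \<noteq> (last p \<in> S)"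
proof (induction G p es rule: walk.induct)
  case (2 G u v p e es)
  then have "ends G e = Upair u v" "e \<in> edges G" by auto
  then have "e \<in> cut G S \<longleftrightarrow> (u \<in> S) \<noteq> (v \<in> S)" using mem_cut by metis
  then show ?case using 2 by auto
qed auto

section \<open>The invariant from edge-connectivity and regularity\<close>

lemma card_cut_ge_if_edge_connected:
  assumes "finite (edges G)" "edge_connected k G" "S \<subseteq> verts G" "S \<noteq> {}" "S \<noteq> verts G"
  shows "k \<le> card (cut G S)"
proof (rule ccontr)
  assume "\<not> ?thesis"
  then have con: "connected (remove_edges G (cut G S))" (is "connected ?H")
    using assms(2) cut_subset[of G S] by (auto simp: edge_connected_def)
  obtain u w where "u \<in> S" "w \<in> verts G - S" using assms(3-) by blast
  moreover from this have "u \<in> verts ?H" "w \<in> verts ?H"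
    using assms(3) by (auto simp: remove_edges_def)
  then obtain p es where p: "walk ?H p es" "hd p = u" "last p = w"
    using con unfolding connected_def by blast
  moreover have "cut ?H S = {}" by (auto simp: cut_def remove_edges_def)
  ultimately show False using walk_crossings[OF p(1), of S] by simp
qed

lemma degree_eq_cut:
  assumes "finite (edges G)"
  shows "degree G v = card (cut G {v}) + 2 * card {e \<in> edges G. ends G e = Upair v v}"
proof -
  have "{e \<in> edges G. v \<in> set_uprod (ends G e)} = cut G {v} \<union> {e \<in> edges G. ends G e = Upair v v}"
    using cut_singleton_iff[of _ G v] cut_subset[of G "{v}"] by auto
  moreover have "cut G {v} \<inter> {e \<in> edges G. ends G e = Upair v v} = {}"
    by (auto simp: cut_def)
  ultimately have "card {e \<in> edges G. v \<in> set_uprod (ends G e)}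
      = card (cut G {v}) + card {e \<in> edges G. ends G e = Upair v v}"
    using assms finite_cut by (metis (no_types, lifting) card_Un_disjoint finite_subset mem_Collect_eq subsetI)
  then show ?thesis by (simp add: degree_def)
qed

lemma even_card_cut:
  assumes "signed_graph G" "\<And>v. v \<in> verts G \<Longrightarrow> even (card (cut G {v}))"
  shows "even (card (cut G S))"
proof -
  have fin: "finite (verts G)" "finite (edges G)" using assms by (auto simp: signed_graph_def)
  have "even (card (cut G T))" if "finite T" "T \<subseteq> verts G" for T
    using that
  proof (induction T)
    case (insert v T)
    then have "sym_diff {v} T = insert v T" by auto
    then have "cut G (insert v T) = sym_diff (cut G {v}) (cut G T)"
      using cut_sym_diff[of G "{v}" T] by simp
    then have "card (cut G (insert v T)) + 2 * card (cut G {v} \<inter> cut G T) = card (cut G {v}) + card (cut G T)"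
      using card_sym_diff[OF finite_cut finite_cut] fin by metis
    moreover have "even (card (cut G {v}))" "even (card (cut G T))" using insert assms(2) by auto
    ultimately show ?case by presburger
  qed simp
  \<comment> \<open>The set \<open>S\<close> may be infinite or leave \<open>verts G\<close>; its
    complement within \<open>verts G\<close> is finite and has the same cut.\<close>
  from this[of "verts G - S"] show ?thesis using fin cut_Compl_verts[OF assms(1)] by simp
qed

text \<open>A circuit crosses a cut evenly, so switching preserves the odd parity of its negative
  edges.\<close>

lemma unbalanced_circuit_meets_switched:
  assumes "finite (edges G)" "circuit G p es" "unbalanced G es"
  shows "set es \<inter> switched G S \<noteq> {}"
proof
  assume e: "set es \<inter> switched G S = {}"
  have "set es \<inter> neg_edges G = set es \<inter> cut G S" using e by auto
  moreover have "card (set es \<inter> cut G S) = length (filter (\<lambda>e. e \<in> cut G S) es)"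
    using assms(2) distinct_card[of "filter (\<lambda>e. e \<in> cut G S) es"]
    by (auto simp: circuit_def Int_def)
  moreover have "even (length (filter (\<lambda>e. e \<in> cut G S) es))"
    using assms(2) walk_crossings[of G p es S] by (auto simp: circuit_def)
  ultimately show False using assms(3) by (simp add: unbalanced_def)
qed

lemma odd_card_switched:
  assumes "finite (edges G)" "even (card (cut G S))"
  shows "odd (card (switched G S)) \<longleftrightarrow> odd (card (neg_edges G))"
  using card_sym_diff[OF finite_neg_edges finite_cut, OF assms(1) assms(1), of S] assms(2) by presburger

lemma six_linked_if_edge_connected:
  assumes G: "signed_graph G" "edge_connected 6 G" "regular 6 G" "odd (card (neg_edges G))"
    and p: "circuit G p es" "unbalanced G es" and q: "circuit G q fs" "unbalanced G fs"
    and disj: "set es \<inter> set fs = {}" and b: "b \<in> verts G"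
  shows "six_linked G b"
proof -
  have fin: "finite (edges G)" using G by (auto simp: signed_graph_def)
  have big: "6 \<le> card (cut G S)" if "S \<subseteq> verts G" "S \<noteq> {}" "S \<noteq> verts G" for S
    using card_cut_ge_if_edge_connected[OF fin G(2) that] .
  have deg: "card (cut G {v}) + 2 * card {e \<in> edges G. ends G e = Upair v v} = 6"
    if "v \<in> verts G" for v
    using degree_eq_cut[OF fin, of v] G(3) that by (simp add: regular_def)
  have ev: "even (card (cut G S))" for S
  proof (rule even_card_cut[OF G(1)])
    fix v assume "v \<in> verts G"
    from deg[OF this] show "even (card (cut G {v}))" by presburger
  qed
  have "card (cut G {u}) = 6 \<and> (\<forall>e\<in>edges G. ends G e \<noteq> Upair u u)" if "u \<in> verts G - {b}" for u
  proof -
    \<comment> \<open>As \<open>b\<close> differs from \<open>u\<close>, the set \<open>{u}\<close>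
      is a proper subset of the vertices. Its cut exhausts the degree six and leaves no room for
      loops.\<close>
    have "6 \<le> card (cut G {u})" using that b by (intro big) auto
    then have "card (cut G {u}) = 6" "card {e \<in> edges G. ends G e = Upair u u} = 0"
      using deg[of u] that by auto
    then show ?thesis using fin by auto
  qed
  moreover have "odd (card (switched G S)) \<and> 3 \<le> card (switched G S)" for S
  proof -
    have fs: "finite (switched G S)" using finite_cut finite_neg_edges fin by blast
    \<comment> \<open>One negative edge from each of the two disjoint circuits makes two; oddness
      raises this to three.\<close>
    obtain e f where ef: "e \<in> set es \<inter> switched G S" "f \<in> set fs \<inter> switched G S"
      using unbalanced_circuit_meets_switched[OF fin p] unbalanced_circuit_meets_switched[OF fin q] by blast
    then have "e \<noteq> f" using disj by blast
    then have "2 \<le> card (switched G S)"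
      using ef card_mono[OF fs, of "{e, f}"] by auto
    moreover have "odd (card (switched G S))"
      using odd_card_switched[OF fin ev] G(4) by blast
    ultimately show ?thesis by presburger
  qed
  ultimately show ?thesis unfolding six_linked_def using G(1) b big ev by blast
qed

text \<open>All edges are loops at \<open>b\<close> and all cuts are empty, so only the parity of
  negative edges matters: two single negative loops and the remaining edges do.\<close>

lemma decomposable_single_vertex:
  assumes "six_linked G b" "verts G = {b}"
  shows "decomposable G b"
proof -
  have fin: "finite (edges G)" and loops: "\<And>e. e \<in> edges G \<Longrightarrow> set_uprod (ends G e) \<subseteq> {b}"
    using assms by (auto simp: six_linked_def signed_graph_def)
  have no_cut: "cut G S = {}" for S
    using loops by (fastforce simp: cut_def)
  have card: "odd (card (neg_edges G))" "3 \<le> card (neg_edges G)"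
    using assms(1) unfolding six_linked_def by (metis Diff_empty Un_empty_right cut_empty empty_Diff)+
  then obtain N where "N \<subseteq> neg_edges G" "card N = 3" by (meson obtain_subset_with_card_n)
  then obtain e f where ef: "e \<in> neg_edges G" "f \<in> neg_edges G" "e \<noteq> f"
    by (auto simp: card_3_iff)
  have root: "rooted_odd G b A" if "A \<subseteq> edges G" "odd (card (A \<inter> neg_edges G))" for A
    using that loops unfolding rooted_odd_def no_cut by fastforce
  let ?C = "edges G - {e, f}"
  have sub: "neg_edges G \<subseteq> edges G" by (auto simp: neg_edges_def)
  have "?C \<inter> neg_edges G = neg_edges G - {e, f}" using sub by auto
  then have "card (?C \<inter> neg_edges G) = card (neg_edges G) - 2"
    using ef finite_neg_edges[OF fin] by (simp add: card_Diff_subset)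
  then have "rooted_odd G b ?C" using card by (intro root) auto
  moreover have "rooted_odd G b {e}" "rooted_odd G b {f}"
    using ef sub by (auto intro!: root)
  moreover have "{e} \<union> {f} \<union> ?C = edges G" "{e} \<inter> {f} = {}" "{e} \<inter> ?C = {}" "{f} \<inter> ?C = {}"
    using ef sub by auto
  ultimately show ?thesis unfolding decomposable_def by blast
qed

section \<open>From edge sets back to eulerian subgraphs\<close>

definition part_graph :: "('v, 'e) sgraph \<Rightarrow> 'v \<Rightarrow> 'e set \<Rightarrow> ('v, 'e) sgraph" where
  "part_graph G b A = G\<lparr>verts := insert b (\<Union>e\<in>A. set_uprod (ends G e)), edges := A\<rparr>"

lemma odd_eulerian_part_graph:
  assumes G: "signed_graph G" "b \<in> verts G" and A: "rooted_odd G b A"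
  shows "odd_eulerian_subgraph (part_graph G b A) G"
proof -
  let ?H = "part_graph G b A"
  have sub: "A \<subseteq> edges G" using A by (simp add: rooted_odd_def)
  have finA: "finite A" using sub G finite_subset by (auto simp: signed_graph_def)
  have simps: "edges ?H = A" "ends ?H = ends G" "sign ?H = sign G"
    "verts ?H = insert b (\<Union>e\<in>A. set_uprod (ends G e))"
    by (simp_all add: part_graph_def)
  have cut: "cut ?H S = A \<inter> cut G S" for S using sub by (auto simp: cut_def simps)
  have "finite (set_uprod (ends G e))" for e by (cases "ends G e") auto
  then have "subgraph ?H G"
    using G sub finA unfolding subgraph_def signed_graph_def simps by auto
  moreover have "neg_edges ?H = A \<inter> neg_edges G" using sub by (auto simp: neg_edges_def simps)
  then have "odd (card (neg_edges ?H))" using A by (simp add: rooted_odd_def)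
  moreover have "even (degree ?H v)" for v
    using A finA by (simp add: degree_eq_cut simps cut rooted_odd_def)
  moreover have "\<exists>p es. walk ?H p es \<and> hd p = u \<and> last p = v" if uv: "u \<in> verts ?H" "v \<in> verts ?H" for u v
  proof -
    \<comment> \<open>No edge of \<open>A\<close> leaves the set \<open>R\<close> of vertices from
      which \<open>v\<close> can be reached. The connectedness clause of \<open>rooted_odd\<close>,
      applied to \<open>R\<close>, puts \<open>b\<close> into \<open>R\<close>; applied to the
      complement of \<open>R\<close>, it then shows that no edge of \<open>A\<close> touches the
      outside.\<close>
    define R where "R = {w. \<exists>p es. walk ?H p es \<and> hd p = w \<and> last p = v}"
    have step: "w \<in> R" if w': "w' \<in> R" and e: "e \<in> A" "ends G e = Upair w w'" for w w' e
    proof -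
      obtain p es where p: "walk ?H p es" "hd p = w'" "last p = v" using w' by (auto simp: R_def)
      then obtain p' where p': "p = w' # p'" by (cases p) auto
      have "w \<in> verts ?H" using e by (force simp: simps)
      then have "walk ?H (w # p) (e # es)" using p p' e by (simp add: simps)
      moreover have "last (w # p) = v" using p p' by simp
      ultimately show ?thesis unfolding R_def by (metis (mono_tags, lifting) list.sel(1) mem_Collect_eq)
    qed
    have "v \<in> R"
      unfolding R_def using uv(2) by (intro CollectI exI[of _ "[v]"] exI[of _ "[]"]) simp
    have closed: "e \<notin> cut G R" if "e \<in> A" for e
      using that step by (auto simp: cut_def dest: Upair_inject[THEN iffD1])
    have closed': "A \<inter> cut G (- R) = {}"
    proof -
      have "cut G (- R) = cut G R"
      proof (rule set_eqI)
        fix e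
        obtain a c where ac: "ends G e = Upair a c" by (rule uprod_ends)
        show "e \<in> cut G (- R) \<longleftrightarrow> e \<in> cut G R" unfolding mem_cut[OF ac] by auto
      qed
      then show ?thesis using closed by blast
    qed
    have "b \<in> R"
    proof (rule ccontr)
      assume "b \<notin> R"
      moreover from this have "\<exists>e\<in>A. set_uprod (ends G e) \<inter> R \<noteq> {}"
        using \<open>v \<in> R\<close> uv(2) by (auto simp: simps)
      ultimately have "A \<inter> cut G R \<noteq> {}" using A unfolding rooted_odd_def by blast
      then show False using closed by blast
    qed
    then have "\<forall>e\<in>A. set_uprod (ends G e) \<inter> (- R) = {}"
      using A closed' unfolding rooted_odd_def by (metis ComplD)
    then have "u \<in> R" using uv(1) \<open>b \<in> R\<close> by (auto simp: simps)
    then show ?thesis by (simp add: R_def)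
  qed
  ultimately show ?thesis
    unfolding odd_eulerian_subgraph_def eulerian_def connected_def by (auto simp: simps)
qed

lemma decomposition_if_decomposable:
  assumes "signed_graph G" "b \<in> verts G" "decomposable G b"
  shows "\<exists>G1 G2 G3. rooted_3_odd_decomposition G G1 G2 G3"
proof -
  obtain A B C where ABC: "rooted_odd G b A" "rooted_odd G b B" "rooted_odd G b C"
    "A \<union> B \<union> C = edges G" "A \<inter> B = {}" "A \<inter> C = {}" "B \<inter> C = {}"
    using assms(3) by (auto simp: decomposable_def)
  have "rooted_3_odd_decomposition G (part_graph G b A) (part_graph G b B) (part_graph G b C)"
    unfolding rooted_3_odd_decomposition_def
    using ABC(1-3)[THEN odd_eulerian_part_graph[OF assms(1,2)]] ABC(4-)
    by (auto simp: part_graph_def)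
  then show ?thesis by blast
qed

section \<open>The induction step\<close>

text \<open>A cut depends only on the trace of \<open>S\<close> on \<open>verts G\<close>. This
  extends the bound to the arbitrary sets at which the signature may be switched.\<close>

lemma cut_trivial_or_ge_6:
  assumes "signed_graph G" "\<And>S. S \<subseteq> verts G \<Longrightarrow> S \<noteq> {} \<Longrightarrow> S \<noteq> verts G \<Longrightarrow> 6 \<le> card (cut G S)"
  shows "cut G S = {} \<or> 6 \<le> card (cut G S)"
proof -
  have "cut G (verts G - S) = cut G S" using cut_Compl_verts[OF assms(1)] .
  moreover have "cut G (verts G) = {}" using cut_Compl_verts[OF assms(1), of "{}"] by simp
  ultimately show ?thesis using assms(2)[of "verts G - S"] by (metis Diff_subset cut_empty)
qed

lemma six_linked_reduce:
  fixes G :: "('v, 'e) sgraph"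
  assumes G: "six_linked G b" and v: "v \<in> verts G - {b}"
  obtains H :: "('v, 'e) sgraph" where "six_linked H b" "verts H = verts G - {v}" "decomposable H b \<longrightarrow> decomposable G b"
proof -
  have sg: "signed_graph G" and b: "b \<in> verts G"
    and big: "\<And>S. S \<subseteq> verts G \<Longrightarrow> S \<noteq> {} \<Longrightarrow> S \<noteq> verts G \<Longrightarrow> 6 \<le> card (cut G S)"
    and ev: "\<And>S. even (card (cut G S))"
    and deg: "\<And>u. u \<in> verts G - {b} \<Longrightarrow> card (cut G {u}) = 6"
    and loopless: "\<And>u e. u \<in> verts G - {b} \<Longrightarrow> e \<in> edges G \<Longrightarrow> ends G e \<noteq> Upair u u"
    and odd: "\<And>S. odd (card (switched G S))" and ge3: "\<And>S. 3 \<le> card (switched G S)"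
    using G unfolding six_linked_def by blast+
  have fin: "finite (edges G)" using sg by (auto simp: signed_graph_def)
  have finc: "finite (cut G S)" for S using finite_cut[OF fin] .
  have fins: "finite (switched G S)" for S using finc finite_neg_edges[OF fin] by blast
  let ?E = "cut G {v}"
  have card_E: "card ?E = 6" using deg[OF v] .

  \<comment> \<open>Pairs will run between \<open>T\<close> and the other three edges, so no two
    edges of \<open>T\<close> are joined. A switching with three negative edges therefore has those
    at \<open>v\<close> placed in \<open>T\<close>.\<close>
  obtain T where T: "T \<subseteq> ?E" "card T = 3"
    and T_cases: "(\<exists>S. switched G S \<inter> ?E \<subseteq> T \<and> card (switched G S) = 3) \<or> (\<forall>S. 5 \<le> card (switched G S))"
  proof (cases "\<exists>S. card (switched G S) = 3")
    case True
    then obtain S where S: "card (switched G S) = 3" by blast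
    have "card (switched G S \<inter> ?E) \<le> 3" using S card_mono[OF fins, of "switched G S \<inter> ?E" S] by auto
    then obtain T where "switched G S \<inter> ?E \<subseteq> T" "T \<subseteq> ?E" "card T = 3"
      using exists_subset_between[of "switched G S \<inter> ?E" 3 ?E] card_E finc by auto
    then show ?thesis using S by (intro that[of T]) blast+
  next
    case False
    have "5 \<le> card (switched G S)" for S
    proof -
      have "card (switched G S) \<noteq> 3" using False by blast
      then show ?thesis using odd[of S] ge3[of S] by presburger
    qed
    moreover obtain T where "T \<subseteq> ?E" "card T = 3"
      using obtain_subset_with_card_n[of 3 ?E] card_E by auto
    ultimately show ?thesis by (intro that[of T]) blast+
  qed
  obtain e1 e2 e3 f1 f2 f3 where E: "?E = {e1, e2, e3, f1, f2, f3}" and Te: "T = {e1, e2, e3}"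
    and dist: "distinct [e1, e2, e3, f1, f2, f3]"
    and sep: "\<not> inseparable G v e1 f1" "\<not> inseparable G v e2 f2" "\<not> inseparable G v e3 f3"
    by (rule cross_matching[OF card_E T inseparable_sym inseparable_trans[OF G v] inseparable_small[OF G v]])
  obtain H where H: "signed_graph H" "verts H = verts G - {v}"
    and cut_H: "\<And>S. cut H S = merge e3 f3 (merge e2 f2 (merge e1 f1 (cut G S)))"
    and neg_H: "neg_edges H = merge e3 f3 (merge e2 f2 (merge e1 f1 (neg_edges G)))"
    and loops_H: "\<And>u e. e \<in> edges H \<Longrightarrow> ends H e = Upair u u \<Longrightarrow>
       (e \<in> edges G \<and> ends G e = Upair u u) \<or>
       (\<exists>(e, f) \<in> {(e1, f1), (e2, f2), (e3, f3)}. e \<in> cut G {u} \<and> f \<in> cut G {u})"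
    and lift: "\<And>b. decomposable H b \<Longrightarrow> decomposable G b"
  proof (rule complete_split_off[OF sg E dist])
    show "\<forall>e\<in>edges G. ends G e \<noteq> Upair v v" using loopless[OF v] by blast
  qed blast
  \<comment> \<open>The number of edges that an edge set loses in the splitting: two for every pair
    contained in it.\<close>
  define k where "k T = (if e1 \<in> T \<and> f1 \<in> T then 2 else 0) + (if e2 \<in> T \<and> f2 \<in> T then 2 else 0)
    + (if e3 \<in> T \<and> f3 \<in> T then 2 else (0::nat))" for T
  have switched_H: "switched H S = merge e3 f3 (merge e2 f2 (merge e1 f1 (switched G S)))" for S
    using dist by (simp only: cut_H neg_H merge_sym_diff distinct.simps list.set insert_iff de_Morgan_disj)
      (simp add: merge_sym_diff)
  have card_cut: "card (cut G S) = card (cut H S) + k (cut G S)" for S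
    using card_merge3[OF finc dist] by (simp add: cut_H k_def)
  have card_sw: "card (switched G S) = card (switched H S) + k (switched G S)" for S
    using card_merge3[OF fins dist] by (simp only: switched_H k_def add.assoc)
  have even_k: "even (k S)" for S by (simp add: k_def)

  have not_tight: "k (cut G X) = 0" if "tight G v X" for X
    using that sep unfolding k_def inseparable_def by auto
  have k_le: "k S \<le> card (?E \<inter> S)" for S
  proof -
    let ?U = "(if e1 \<in> S \<and> f1 \<in> S then {e1, f1} else {}) \<union> (if e2 \<in> S \<and> f2 \<in> S then {e2, f2} else {})
      \<union> (if e3 \<in> S \<and> f3 \<in> S then {e3, f3} else {})"
    have "k S = card ?U" using dist by (auto simp: k_def)
    also have "\<dots> \<le> card (?E \<inter> S)" using finc by (intro card_mono) (auto simp: E split: if_splits)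
    finally show ?thesis .
  qed

  \<comment> \<open>The cut of \<open>X\<close> in \<open>G\<close> must exceed six by the loss
    \<open>k\<close>. A loss of two makes \<open>X\<close> not tight, so evenness gives eight edges.
    For losses four and six, at least as many edges join \<open>v\<close> to \<open>X\<close>, and
    the cut has at least twice that many; this suffices except for loss four and exactly eight
    edges.\<close>
  have big_H: "6 \<le> card (cut H X)" if X: "X \<subseteq> verts H" "X \<noteq> {}" "X \<noteq> verts H" for X
  proof -
    have X': "X \<subseteq> verts G - {v}" "X \<noteq> verts G - {v}" using X H by auto
    have d: "6 \<le> card (cut G X)" using X X' v by (intro big) auto
    define c where "c = card (?E \<inter> cut G X)"
    have kc: "k (cut G X) \<le> c" using k_le by (simp add: c_def)
    have "sym_diff {v} X = insert v X" using X' by auto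
    then have eq: "cut G (insert v X) = sym_diff ?E (cut G X)"
      using cut_sym_diff[of G "{v}" X] by simp
    have dv: "card (cut G (insert v X)) + 2 * c = 6 + card (cut G X)"
      using card_sym_diff[OF finc finc, of "{v}" X] card_E unfolding eq c_def by simp
    have "6 \<le> card (cut G (insert v X))" using X X' v by (intro big) auto
    then have dc: "2 * c \<le> card (cut G X)" using dv by simp
    have "k (cut G X) = 0 \<or> k (cut G X) = 2 \<or> k (cut G X) = 4 \<or> k (cut G X) = 6"
      by (simp add: k_def)
    then consider "k (cut G X) = 0" | "k (cut G X) = 2" | "k (cut G X) = 4" | "k (cut G X) = 6"
      by (elim disjE)
    then have "6 + k (cut G X) \<le> card (cut G X)"
    proof cases
      case 1 then show ?thesis using d by simp
    next
      case 2
      then have "\<not> tight G v X" using not_tight[of X] by auto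
      then have "card (cut G X) \<noteq> 6" using X X' by (auto simp: tight_def)
      then show ?thesis using d 2 ev[of X] by presburger
    next
      case 3
      have "card (cut G X) \<noteq> 8"
      proof
        assume 8: "card (cut G X) = 8"
        then have "c = 4" using 3 kc dc by simp
        then have six: "card (cut G (insert v X)) = 6" using dv 8 by simp
        \<comment> \<open>The other side \<open>?Y\<close> is then tight and contains the other ends of the third pair.\<close>
        let ?Y = "verts G - insert v X"
        have cutY: "cut G ?Y = cut G (insert v X)" using cut_Compl_verts[OF sg] .
        have "tight G v ?Y" using six X X' cutY by (auto simp: tight_def)
        then have "k (cut G (insert v X)) = 0" using not_tight cutY by metis
        have "\<exists>(e, f) \<in> {(e1, f1), (e2, f2), (e3, f3)}. e \<notin> cut G X \<and> f \<notin> cut G X"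
        proof (rule ccontr)
          assume none: "\<not> ?thesis"
          \<comment> \<open>Two pairs lie in the cut; if the third meets it as well, at most one
            edge at \<open>v\<close> is missing.\<close>
          have "5 \<le> c"
          proof -
            have "\<exists>g. {e1, e2, e3, f1, f2, f3} - {g} \<subseteq> cut G X"
              using none 3 by (auto simp: k_def split: if_splits)
            then obtain g where "?E - {g} \<subseteq> ?E \<inter> cut G X" using E by blast
            then have "card (?E - {g}) \<le> c" unfolding c_def using finc by (intro card_mono) auto
            moreover have "card ?E - 1 \<le> card (?E - {g})" by (simp add: card_Diff_singleton_if)
            ultimately show ?thesis using card_E by simp
          qed
          then show False using \<open>c = 4\<close> by simp
        qed
        \<comment> \<open>The edges of the pair that avoids \<open>X\<close> lead from
          \<open>v\<close> to \<open>?Y\<close>, so both lie in this cut.\<close>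
        then have "k (cut G (insert v X)) \<noteq> 0" unfolding eq by (auto simp: k_def E)
        then show False using \<open>k (cut G (insert v X)) = 0\<close> by simp
      qed
      then show ?thesis using 3 kc dc ev[of X] by presburger
    next
      case 4 then show ?thesis using kc dc by simp
    qed
    then show ?thesis using card_cut[of X] by simp
  qed

  have sw_H_odd: "odd (card (switched H S))" for S
    using card_sw[of S] odd[of S] even_k[of "switched G S"] by presburger
  have "3 \<le> card (switched H R)" for R
    using T_cases
  proof
    assume "\<exists>S. switched G S \<inter> ?E \<subseteq> T \<and> card (switched G S) = 3"
    then obtain S where S: "switched G S \<inter> ?E \<subseteq> T" "card (switched G S) = 3" by blast
    \<comment> \<open>Each pair has one edge outside \<open>T\<close>, which is positive in this
      switching, so nothing cancels.\<close>
    have "f1 \<in> ?E - T" "f2 \<in> ?E - T" "f3 \<in> ?E - T"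
      using dist unfolding E Te by auto
    then have "f1 \<notin> switched G S" "f2 \<notin> switched G S" "f3 \<notin> switched G S"
      using S(1) by blast+
    then have "k (switched G S) = 0"
      by (simp only: k_def simp_thms if_False add_0)
    then have S3: "card (switched H S) = 3" using card_sw[of S] S(2) by simp
    have finH: "finite (edges H)" using H by (auto simp: signed_graph_def)
    \<comment> \<open>The two switchings differ by this cut, which is empty or has at least six
      edges, at most three of them negative at \<open>S\<close>: at least 3 + 6 - 2 * 3 negative
      edges remain in the second case.\<close>
    let ?C = "cut H (sym_diff S R)"
    have eq: "switched H R = sym_diff (switched H S) ?C"
      unfolding cut_sym_diff by blast
    have fS: "finite (switched H S)" using S3 by (metis card.infinite zero_neq_numeral)
    have "card (switched H S \<inter> ?C) \<le> 3" using S3 card_mono[OF fS, of "switched H S \<inter> ?C"] by auto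
    moreover have "card (switched H R) + 2 * card (switched H S \<inter> ?C) = 3 + card ?C"
      using card_sym_diff[OF fS finite_cut[OF finH], of "sym_diff S R"]
      unfolding eq[symmetric] S3 .
    ultimately show ?thesis
      using cut_trivial_or_ge_6[OF H(1) big_H, of "sym_diff S R"] by auto
  next
    assume five: "\<forall>S. 5 \<le> card (switched G S)"
    \<comment> \<open>With at most three negative edges at \<open>v\<close>, the even loss
      \<open>k\<close> is at most two, and five minus two is three.\<close>
    have *: "3 \<le> card (switched H Q)" if "card (?E \<inter> switched G Q) \<le> 3" for Q
    proof -
      have "k (switched G Q) \<le> 3" using that k_le[of "switched G Q"] by linarith
      moreover have "k (switched G Q) \<noteq> 3" using even_k[of "switched G Q"] by force
      moreover have "5 \<le> card (switched G Q)" using five by blast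
      ultimately show ?thesis using card_sw[of Q] by linarith
    qed
    show ?thesis
    proof (cases "card (?E \<inter> switched G R) \<le> 3")
      case True then show ?thesis by (rule *)
    next
      case False
      \<comment> \<open>Switching also at \<open>v\<close> complements the negative edges at
        \<open>v\<close>, leaving at most two, and changes nothing in \<open>H\<close>, where
        \<open>v\<close> is gone.\<close>
      let ?Q = "sym_diff R {v}"
      have "?E \<inter> switched G ?Q = ?E - ?E \<inter> switched G R" unfolding cut_sym_diff by blast
      then have "card (?E \<inter> switched G ?Q) = card ?E - card (?E \<inter> switched G R)"
        using finc by (simp add: card_Diff_subset)
      then have "3 \<le> card (switched H ?Q)" using False card_E by (intro *) simp
      moreover have "cut H {v} = {}"
      proof -
        have "verts H - {v} = verts H" using H(2) by auto
        then show ?thesis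
          using cut_Compl_verts[OF H(1), of "{v}"] cut_Compl_verts[OF H(1), of "{}"] by simp
      qed
      then have "cut H ?Q = cut H R" unfolding cut_sym_diff by simp
      ultimately show ?thesis by simp
    qed
  qed
  moreover have "card (cut H {u}) = 6 \<and> (\<forall>e\<in>edges H. ends H e \<noteq> Upair u u)"
    if u: "u \<in> verts H - {b}" for u
  proof -
    have u': "u \<in> verts G - {b}" using u H by auto
    \<comment> \<open>The vertex \<open>b\<close> keeps \<open>{u}\<close> from being all of
      \<open>verts G - {v}\<close>, so \<open>{u}\<close> is tight. Hence its cut loses nothing and
      no pair becomes a loop at \<open>u\<close>.\<close>
    have "b \<in> verts G - {v}" "b \<noteq> u" "u \<in> verts G - {v}" using u b v H(2) by auto
    then have "tight G v {u}" using deg[OF u'] unfolding tight_def by blast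
    then have k0: "k (cut G {u}) = 0" by (rule not_tight)
    then have "card (cut H {u}) = 6" using card_cut[of "{u}"] deg[OF u'] by simp
    moreover have "ends H e \<noteq> Upair u u" if "e \<in> edges H" for e
      using loops_H[OF that, of u] loopless[OF u'] k0 by (auto simp: k_def split: if_splits)
    ultimately show ?thesis by blast
  qed
  moreover have "even (card (cut H S))" for S
    using card_cut[of S] ev[of S] even_k[of "cut G S"] by presburger
  moreover have "b \<in> verts H" using H b v by auto
  ultimately have "six_linked H b"
    unfolding six_linked_def using H(1) big_H sw_H_odd by blast
  then show thesis using H(2) lift by (intro that[of H] impI)
qed

section \<open>Induction on the number of vertices and conclusion\<close>

lemma decomposable_if_six_linked:
  fixes G :: "('v, 'e) sgraph"
  shows "six_linked G b \<Longrightarrow> decomposable G b"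
proof (induction "card (verts G)" arbitrary: G rule: less_induct)
  case less
  show ?case
  proof (cases "verts G = {b}")
    case True
    then show ?thesis by (rule decomposable_single_vertex[OF less.prems])
  next
    case False
    have "b \<in> verts G" "signed_graph G" using less.prems unfolding six_linked_def by blast+
    then obtain v where v: "v \<in> verts G - {b}" using False by blast
    obtain H :: "('v, 'e) sgraph" where H: "six_linked H b" "verts H = verts G - {v}"
      "decomposable H b \<longrightarrow> decomposable G b"
      by (rule six_linked_reduce[OF less.prems v])
    have "finite (verts G)" using \<open>signed_graph G\<close> by (simp add: signed_graph_def)
    then have "card (verts H) < card (verts G)" using v unfolding H(2) by (intro card_Diff1_less) auto
    from H(3)[rule_format, OF less.hyps[OF this H(1)]] show ?thesis .
  qed
qed

theorem theorem5p2:
  fixes G :: "('v, 'e) sgraph"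
  assumes "signed_graph G"
    and "edge_connected 6 G"
    and "regular 6 G"
    and "odd (card (neg_edges G))"
    and "\<exists>p es q fs. circuit G p es \<and> unbalanced G es \<and>
           circuit G q fs \<and> unbalanced G fs \<and> set es \<inter> set fs = {}"
  shows "\<exists>G1 G2 G3. rooted_3_odd_decomposition G G1 G2 G3"
proof -
  obtain p es q fs where *: "circuit G p es" "unbalanced G es" "circuit G q fs" "unbalanced G fs"
    "set es \<inter> set fs = {}" using assms(5) by blast
  have "connected (remove_edges G {})" using assms(2) by (auto simp: edge_connected_def)
  then obtain b where b: "b \<in> verts G" by (auto simp: connected_def remove_edges_def)
  have "six_linked G b" using six_linked_if_edge_connected[OF assms(1-4) * b] .
  then show ?thesis
    using decomposition_if_decomposable[OF assms(1) b decomposable_if_six_linked] by simp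
qed

end
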